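(* Let $N>1$ be an odd integer, let $b,c\in\mathbb{R}$ with $c\neq 0$, and let $g:\mathbb{Z}^+\times\mathbb{R}\to\mathbb{R}$ be continuous and $N$-periodic in its first variable. Let $r,\hat z,\delta$ be positive constants and suppose the following conditions hold (with $M_p$ and $Q$ the operators associated with $b,c,N$ defined in the context): (C1) $|g(t,x)|\leq\delta$ for all $t\in\mathbb{Z}^+$ and all $x\in[-2r,2r]$; (C2) $x\,g(t,x)>0$ for all $t\in\mathbb{Z}^+$ and all $x\in\mathbb{R}$ with $|x|>\hat z$; (C3) $\hat z+\|M_p(I-Q)\|\,\delta<r$, where $\|M_p(I-Q)\|$ is the operator norm on $X_N$; (C4) if $N\arccos(-\tfrac b2)$ is a multiple of $2\pi$, then $c\neq 1$ or $2\leq|b|$. Then the equation $$y(t+2)+b\,y(t+1)+c\,y(t)=g(t,y(t)),\qquad t\in\mathbb{Z}^+,$$ has an $N$-periodic solution $y:\mathbb{Z}^+\to\mathbb{R}$.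
   Context: Here $\mathbb{Z}^+$ denotes the nonnegative integers $\{0,1,2,\dots\}$, and a function $\phi$ on $\mathbb{Z}^+$ is $N$-periodic if $\phi(t+N)=\phi(t)$ for all $t\in\mathbb{Z}^+$. In (C4), the condition concerns $\arccos(-b/2)$ only when $|b|\leq 2$; for $|b|>2$ condition (C4) holds automatically. Let $A=\begin{pmatrix}0&1\\-c&-b\end{pmatrix}$, which is invertible. Let $X_N$ be the space of $N$-periodic functions $\phi:\mathbb{Z}^+\to\mathbb{R}^2$ with the supremum norm $\|\phi\|=\sup_t|\phi(t)|$, where $|\cdot|$ is the Euclidean norm; operators on $X_N$ carry the corresponding operator norm. Define $\mathcal{L}:X_N\to X_N$ by $(\mathcal{L}x)(t)=x(t+1)-Ax(t)$ and $\mathcal{L}^*:X_N\to X_N$ by $(\mathcal{L}^*x)(t)=x(t+1)-A^{-T}x(t)$, where $A^{-T}=(A^{-1})^T$. Let $V$ be the orthogonal projection of $\mathbb{R}^2$ onto $\mathrm{Ker}(I-A^N)$ and define $P:X_N\to X_N$ by $(Px)(t)=A^tVx(0)$; $P$ is a projection onto $\mathrm{Ker}(\mathcal{L})$. Under (C4) with $N$ odd, $\mathrm{Ker}(\mathcal{L})$ and $\mathrm{Ker}(\mathcal{L}^* )$ are both either trivial or one-dimensional. If they are trivial, set $Q=0$. Otherwise let $\Psi$ be a function whose single column spans $\mathrm{Ker}(\mathcal{L}^* )$ (it is spanned by the constant function $(-c,1)^T$) and define $Q:X_N\to X_N$ by $$(Qh)(t)=\Psi(t)\Big(\sum_{j=0}^{N-1}|\Psi(j)|^2\Big)^{-1}\sum_{i=0}^{N-1}\Psi^T(i)h(i);$$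 $Q$ is a projection with $\mathrm{Ker}(Q)=\mathrm{Im}(\mathcal{L})$. $M_p:\mathrm{Im}(\mathcal{L})\to\mathrm{Ker}(P)$ denotes the inverse of the restriction $\mathcal{L}|_{\mathrm{Ker}(P)}:\mathrm{Ker}(P)\to\mathrm{Im}(\mathcal{L})$. In particular, if $\mathcal{L}$ is invertible then $P=Q=0$ and $M_p(I-Q)=\mathcal{L}^{-1}$. *)

theory Defs
  imports "HOL-Analysis.Analysis"
begin

definition periodic :: "nat \<Rightarrow> (nat \<Rightarrow> 'a) \<Rightarrow> bool"
  where "periodic N \<phi> \<longleftrightarrow> (\<forall>t. \<phi> (t + N) = \<phi> t)"

definition X_space :: "nat \<Rightarrow> (nat \<Rightarrow> real^2) set"
  where "X_space N = {\<phi>. periodic N \<phi>}"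

definition sup_norm :: "(nat \<Rightarrow> real^2) \<Rightarrow> real"
  where "sup_norm \<phi> = (SUP t. norm (\<phi> t))"

text \<open>
  Operators on \<open>X_N\<close> are functions on all sequences in the plane that are only
  meaningful on \<open>X_space N\<close>.  For \<open>N \<ge> 1\<close> the space \<open>X_N\<close> is finite-dimensional, so for
  linear operators the supremum below is over a nonempty bounded set.
\<close>

definition op_norm :: "nat \<Rightarrow> ((nat \<Rightarrow> real^2) \<Rightarrow> (nat \<Rightarrow> real^2)) \<Rightarrow> real"
  where "op_norm N T = (SUP \<phi>\<in>{\<phi> \<in> X_space N. sup_norm \<phi> \<le> 1}. sup_norm (T \<phi>))"

definition ker_on :: "nat \<Rightarrow> ((nat \<Rightarrow> real^2) \<Rightarrow> (nat \<Rightarrow> real^2)) \<Rightarrow> (nat \<Rightarrow> real^2) set"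
  where "ker_on N T = {\<phi> \<in> X_space N. T \<phi> = (\<lambda>t. 0)}"

definition A_mat :: "real \<Rightarrow> real \<Rightarrow> real^2^2"
  where "A_mat b c = vector [vector [0, 1], vector [- c, - b]]"

text \<open>The power \<open>^\<close> on \<open>real^2^2\<close> is the componentwise one, not the matrix power.\<close>

primrec mat_power :: "real^2^2 \<Rightarrow> nat \<Rightarrow> real^2^2"
  where
    "mat_power A 0 = mat 1"
  | "mat_power A (Suc n) = A ** mat_power A n"

definition L_op :: "real \<Rightarrow> real \<Rightarrow> (nat \<Rightarrow> real^2) \<Rightarrow> (nat \<Rightarrow> real^2)"
  where "L_op b c x = (\<lambda>t. x (t + 1) - A_mat b c *v x t)"

definition L_star :: "real \<Rightarrow> real \<Rightarrow> (nat \<Rightarrow> real^2) \<Rightarrow> (nat \<Rightarrow> real^2)"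
  where "L_star b c x = (\<lambda>t. x (t + 1) - transpose (matrix_inv (A_mat b c)) *v x t)"

definition orth_proj :: "(real^2) set \<Rightarrow> real^2 \<Rightarrow> real^2"
  where "orth_proj S v = (THE p. p \<in> S \<and> (\<forall>s\<in>S. orthogonal (v - p) s))"

definition V_proj :: "real \<Rightarrow> real \<Rightarrow> nat \<Rightarrow> real^2 \<Rightarrow> real^2"
  where "V_proj b c N = orth_proj {v. (mat 1 - mat_power (A_mat b c) N) *v v = 0}"

definition P_op :: "real \<Rightarrow> real \<Rightarrow> nat \<Rightarrow> (nat \<Rightarrow> real^2) \<Rightarrow> (nat \<Rightarrow> real^2)"
  where "P_op b c N x = (\<lambda>t. mat_power (A_mat b c) t *v V_proj b c N (x 0))"

text \<open>
  A spanning function of the kernel of \<open>L_star\<close>, when this kernel is one-dimensional.  It is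
  determined up to a nonzero scalar factor, under which \<open>Q_op\<close> below is invariant.
\<close>

definition Psi :: "real \<Rightarrow> real \<Rightarrow> nat \<Rightarrow> (nat \<Rightarrow> real^2)"
  where "Psi b c N = (SOME \<psi>. \<psi> \<noteq> (\<lambda>t. 0) \<and>
    ker_on N (L_star b c) = range (\<lambda>a t. a *\<^sub>R \<psi> t))"

definition Q_op :: "real \<Rightarrow> real \<Rightarrow> nat \<Rightarrow> (nat \<Rightarrow> real^2) \<Rightarrow> (nat \<Rightarrow> real^2)"
  where "Q_op b c N h =
    (if ker_on N (L_star b c) = {\<lambda>t. 0} then (\<lambda>t. 0)
     else (\<lambda>t. (inverse (\<Sum>j<N. (norm (Psi b c N j))\<^sup>2) *
                 (\<Sum>i<N. Psi b c N i \<bullet> h i)) *\<^sub>R Psi b c N t))"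

text \<open>
  The inverse of the restriction of \<open>L_op\<close> to the kernel of \<open>P_op\<close>; it is meaningful only on
  the image of \<open>X_N\<close> under \<open>L_op\<close>.
\<close>

definition M_p :: "real \<Rightarrow> real \<Rightarrow> nat \<Rightarrow> (nat \<Rightarrow> real^2) \<Rightarrow> (nat \<Rightarrow> real^2)"
  where "M_p b c N = inv_into (ker_on N (P_op b c N)) (L_op b c)"

definition M_p_I_minus_Q :: "real \<Rightarrow> real \<Rightarrow> nat \<Rightarrow> (nat \<Rightarrow> real^2) \<Rightarrow> (nat \<Rightarrow> real^2)"
  where "M_p_I_minus_Q b c N h = M_p b c N (\<lambda>t. h t - Q_op b c N h t)"

end

(*
  Put x(t) = (y(t), y(t+1)) and replace g(t, .) by its truncation to [-2r, 2r], which is bounded by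
  delta.  An N-periodic solution is then determined by its initial value, so Brouwer's theorem in
  a fixed finite dimension (rather than in X_N) suffices.  A solution is sought in the form
  x = alpha e + w with e spanning Ker L and w in Ker P.  The unknowns are alpha, w(0) and a
  constant q: follow the trajectory of x(t+1) = A x(t) + F(t, x(t)) - q psi started at
  alpha e + w(0), let h be the N-periodic extension of F(t, x(t)), and map (alpha, w(0), q) to
  (alpha - kappa h clipped to [-r, r], (M_p (I - Q) h)(0), kappa h), where Q h = kappa(h) psi.
  At a fixed point x is N-periodic with w = M_p (I - Q) h, so |w| <= ||M_p (I - Q)|| delta and
  the truncation is inactive.  If kappa h were nonzero, the clipping would force |alpha| = r,
  hence |x_1(t)| > zhat for all t, and the sign condition (C2) contradicts the sign of kappa h.
*)
theory Submission
  imports Defs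
begin

section \<open>Periodic solutions of scalar linear recurrences\<close>

lemma periodic_add_mult: "periodic N f \<Longrightarrow> f (t + k * N) = f t"
  by (induction k) (simp_all add: periodic_def add.assoc[symmetric] add.commute[of N])

lemma periodic_mod: "periodic N f \<Longrightarrow> f (t mod N) = f t"
  by (metis periodic_add_mult mod_mult_div_eq mult.commute)

text \<open>For \<open>l = 1\<close> the sequence grows linearly, so periodicity forces
  \<open>d = 0\<close>. Otherwise subtracting the fixed point \<open>d / (1 - l)\<close> leaves a
  geometric sequence, which can return after \<open>N\<close> steps only if it vanishes,
  \<open>l\<close> not being an \<open>N\<close>-th root of unity.\<close>

lemma periodic_first_order_const:
  fixes z :: "nat \<Rightarrow> complex"
  assumes "N > 0" and per: "periodic N z"
    and rec: "\<And>t. z (Suc t) = l * z t + d"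
    and root: "l ^ N = 1 \<Longrightarrow> l = 1"
  shows "z t = z 0"
proof (cases "l = 1")
  case True
  have *: "z t = z 0 + of_nat t * d" for t
    by (induction t) (simp_all add: rec True algebra_simps)
  have "z N = z 0"
    using per unfolding periodic_def by (metis add_0)
  then have "d = 0"
    using *[of N] \<open>N > 0\<close> by simp
  then show ?thesis using *[of t] by simp
next
  case False
  define u where "u t = z t - d / (1 - l)" for t
  have rec': "u (Suc t) = l * u t" for t
    using False by (simp add: u_def rec field_simps)
  have *: "u t = l ^ t * u 0" for t
    by (induction t) (simp_all add: rec')
  have "u N = u 0"
    using per unfolding periodic_def u_def by (metis add_0)
  then have "u 0 = 0"
    using *[of N] False root by auto
  then have "u t = u 0" using *[of t] by simp
  then show ?thesis by (simp add: u_def)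
qed

text \<open>The recurrence factors as (S - l)(S - m) y = 0 with S the shift. The first-order lemma
  applies once for each factor, the second time with the constant \<open>z 0\<close> as forcing
  term; a double root needs no separate case.\<close>

lemma periodic_second_order_const:
  fixes y :: "nat \<Rightarrow> complex"
  assumes "N > 0" and per: "periodic N y"
    and rec: "\<And>t. y (t + 2) = (l + m) * y (t + 1) - l * m * y t"
    and "l ^ N = 1 \<Longrightarrow> l = 1" and "m ^ N = 1 \<Longrightarrow> m = 1"
  shows "y t = y 0"
proof -
  define z where "z t = y (Suc t) - m * y t" for t
  have perz: "periodic N z"
    using per unfolding periodic_def z_def by (metis add_Suc)
  have "z (Suc t) = l * z t + 0" for t
    using rec[of t] by (simp add: z_def algebra_simps)
  from periodic_first_order_const[OF \<open>N > 0\<close> perz this assms(4)]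
  have "z t = z 0" for t .
  then have "y (Suc t) = m * y t + z 0" for t
    by (metis z_def add.commute diff_add_cancel)
  from periodic_first_order_const[OF \<open>N > 0\<close> per this assms(5)]
  show ?thesis .
qed

text \<open>Oddness and (C4) enter here. A real root of modulus 1 is 1 or -1, and -1 is excluded by
  odd \<open>N\<close>. A nonreal one has its conjugate as second root, so \<open>c = 1\<close> and
  \<open>b = - 2 * Re l\<close>; then \<open>arccos (- b / 2)\<close> is its argument up to sign,
  which (C4) excludes. For |b| > 2 the value of \<open>arccos\<close> does not matter, because the
  conclusion of \<open>C4\<close> is then true.\<close>

lemma quadratic_root_of_unity_eq_1:
  fixes b c :: real and l :: complex
  assumes "odd N"
    and C4: "(\<exists>k::int. real N * arccos (- b / 2) = of_int k * (2 * pi)) \<Longrightarrow> c \<noteq> 1 \<or> 2 \<le> \<bar>b\<bar>"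
    and root: "l\<^sup>2 + of_real b * l + of_real c = 0" and l1: "l ^ N = 1"
  shows "l = 1"
proof -
  have "N > 0" using \<open>odd N\<close> by (rule odd_pos)
  have nl: "norm l = 1"
    using power_eq_1_iff[OF l1] \<open>N > 0\<close> by simp
  show ?thesis
  proof (cases "Im l = 0")
    case True
    then have l: "l = of_real (Re l)" by (simp add: complex_eq_iff)
    then have "Re l = 1 \<or> Re l = -1" using nl
      by (metis norm_of_real abs_eq_iff' abs_1 abs_eq_iff)
    moreover have "Re l \<noteq> -1"
    proof
      assume "Re l = -1"
      then have "l = -1" using l by simp
      then show False using l1 \<open>odd N\<close> by simp
    qed
    ultimately show ?thesis using l by simp
  next
    case False
    have im: "2 * Re l * Im l + b * Im l = 0"
      using arg_cong[OF root, of Im] by (simp add: power2_eq_square algebra_simps)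
    have "(2 * Re l + b) * Im l = 0" using im by (simp add: algebra_simps)
    then have b: "b = - 2 * Re l" using False by simp
    have re: "(Re l)\<^sup>2 - (Im l)\<^sup>2 + b * Re l + c = 0"
      using arg_cong[OF root, of Re] by (simp add: power2_eq_square algebra_simps)
    have sq: "(Re l)\<^sup>2 + (Im l)\<^sup>2 = 1"
      using nl cmod_power2[of l] by simp
    then have c: "c = 1" using re b by (simp add: power2_eq_square algebra_simps)
    have "(Im l)\<^sup>2 > 0" using False by simp
    then have "(Re l)\<^sup>2 < 1" using sq by linarith
    then have re1: "\<bar>Re l\<bar> < 1" by (simp add: abs_square_less_1)
    define \<theta> where "\<theta> = arccos (- b / 2)"
    have \<theta>: "\<theta> = arccos (Re l)" by (simp add: \<theta>_def b)
    have cos: "cos \<theta> = Re l" unfolding \<theta> using re1 by (intro cos_arccos) auto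
    have "(sin \<theta>)\<^sup>2 = (Im l)\<^sup>2"
      using sin_cos_squared_add[of \<theta>] sq unfolding cos by linarith
    then have "sin \<theta> = Im l \<or> sin \<theta> = - Im l" by (simp add: power2_eq_iff)
    then have "cis \<theta> = l \<or> cis \<theta> = cnj l" by (auto simp: complex_eq_iff cos)
    then have "cis \<theta> ^ N = 1" using l1 by (metis complex_cnj_one complex_cnj_power)
    then have "cis (real N * \<theta>) = 1" by (simp add: Complex.DeMoivre)
    then have "cos (real N * \<theta>) = 1" by (simp add: complex_eq_iff)
    then obtain k :: int where "real N * \<theta> = of_int k * (2 * pi)"
      by (auto simp: cos_one_2pi_int)
    then have "c \<noteq> 1 \<or> 2 \<le> \<bar>b\<bar>" using C4 \<theta>_def by blast
    then show ?thesis using c b re1 by auto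
  qed
qed

section \<open>The companion matrix, its trajectories and orthogonal projection\<close>

lemma A_mat_mult:
  "A_mat b c *v x = vector [x $ 2, - c * x $ 1 - b * x $ 2]"
  by (simp add: A_mat_def vec_eq_iff forall_2 matrix_vector_mult_def sum_2)

lemma mult_A_mat:
  "x v* A_mat b c = vector [- c * x $ 2, x $ 1 - b * x $ 2]"
  by (simp add: A_mat_def vec_eq_iff forall_2 vector_matrix_mult_def sum_2)

lemma invertible_A_mat: "c \<noteq> 0 \<Longrightarrow> invertible (A_mat b c)"
  by (simp add: invertible_det_nz det_2 A_mat_def)

lemma mat_power_Suc_mult: "mat_power A (Suc n) *v v = A *v (mat_power A n *v v)"
  by (simp add: matrix_vector_mul_assoc)

lemma mat_power_trajectory:
  assumes "\<And>t. x (Suc t) = A *v x t"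
  shows "x t = mat_power A t *v x 0"
  by (induction t) (simp_all add: assms matrix_vector_mul_assoc)

text \<open>The definite description in \<open>orth_proj\<close> needs a unique foot point: the
  difference of two candidates lies in \<open>S\<close> and is orthogonal to itself. Later only the
  kernel of the projection matters, since it determines Ker(P).\<close>

lemma orth_proj_eq_0_iff:
  assumes "subspace S"
  shows "orth_proj S v = 0 \<longleftrightarrow> (\<forall>s\<in>S. orthogonal v s)"
proof -
  have "\<exists>!p. p \<in> S \<and> (\<forall>s\<in>S. orthogonal (v - p) s)"
  proof -
    obtain p z where p: "p \<in> span S" "\<And>w. w \<in> span S \<Longrightarrow> orthogonal z w" "v = p + z"
      using orthogonal_subspace_decomp_exists[of S v] by metis
    have S: "span S = S" using assms by (simp add: span_eq_iff)
    show ?thesis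
    proof (rule ex1I[of _ p])
      show "p \<in> S \<and> (\<forall>s\<in>S. orthogonal (v - p) s)" using p S by auto
    next
      fix p' assume p': "p' \<in> S \<and> (\<forall>s\<in>S. orthogonal (v - p') s)"
      have d: "p' - p \<in> S" using p' p S assms by (simp add: subspace_diff)
      have "orthogonal (v - p) (p' - p)" "orthogonal (v - p') (p' - p)"
        using p p' S d by auto
      then have "(p' - p) \<bullet> (p' - p) = 0"
        by (simp add: orthogonal_def inner_diff_left)
      then show "p' = p" by simp
    qed
  qed
  from theI'[OF this] this show ?thesis
    unfolding orth_proj_def[symmetric] using subspace_0[OF assms]
    by (metis diff_zero)
qed

lemma quadratic_roots:
  fixes b c :: real
  obtains l m :: complex where "l + m = - of_real b" and "l * m = of_real c"
proof
  let ?d = "csqrt (of_real (b\<^sup>2 - 4 * c))"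
  have d: "?d * ?d = of_real (b\<^sup>2 - 4 * c)"
    by (metis power2_csqrt power2_eq_square)
  show "(- of_real b + ?d) / 2 + (- of_real b - ?d) / 2 = - complex_of_real b"
    by (simp add: field_simps)
  have "(- of_real b + ?d) / 2 * ((- of_real b - ?d) / 2) = (of_real b * of_real b - ?d * ?d) / 4"
    by (simp add: field_simps)
  then show "(- of_real b + ?d) / 2 * ((- of_real b - ?d) / 2) = complex_of_real c"
    unfolding d by (simp add: power2_eq_square)
qed

lemma periodic_trajectory:
  assumes rec: "\<And>t. x (Suc t) = f t (x t)" and f: "\<And>t. f (t + N) = f t" and "x N = x 0"
  shows "periodic N x"
proof -
  have "x (t + N) = x t" for t
    using assms(3) by (induction t) (simp_all add: rec f)
  then show ?thesis by (simp add: periodic_def)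
qed

section \<open>Kernels of \<open>L_op\<close> and \<open>L_star\<close>, and the projections P and
  Q\<close>

locale odd_period =
  fixes N :: nat and b c :: real
  assumes odd_N: "odd N" and c_nz: "c \<noteq> 0"
    and C4: "(\<exists>k::int. real N * arccos (- b / 2) = of_int k * (2 * pi)) \<Longrightarrow> c \<noteq> 1 \<or> 2 \<le> \<bar>b\<bar>"
begin

lemma N_pos: "N > 0"
  using odd_N by (rule odd_pos)

lemma characteristic_roots:
  obtains l m :: complex where "l + m = - of_real b" and "l * m = of_real c"
    and "l ^ N = 1 \<Longrightarrow> l = 1" and "m ^ N = 1 \<Longrightarrow> m = 1"
proof -
  obtain l m :: complex where lm: "l + m = - of_real b" "l * m = of_real c"
    by (rule quadratic_roots)
  have bb: "of_real b = - (l + m)" using lm by simp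
  have "l\<^sup>2 + of_real b * l + of_real c = 0" "m\<^sup>2 + of_real b * m + of_real c = 0"
    unfolding bb lm(2)[symmetric] by (simp_all add: power2_eq_square algebra_simps)
  then show thesis
    using that lm quadratic_root_of_unity_eq_1[OF odd_N C4] by blast
qed

lemma periodic_kernel_const:
  fixes y :: "nat \<Rightarrow> real"
  assumes "periodic N y" and rec: "\<And>t. y (t + 2) + b * y (t + 1) + c * y t = 0"
  shows "y t = y 0"
proof -
  obtain l m :: complex where lm: "l + m = - of_real b" "l * m = of_real c"
    "l ^ N = 1 \<Longrightarrow> l = 1" "m ^ N = 1 \<Longrightarrow> m = 1"
    by (rule characteristic_roots) blast
  have "complex_of_real (y (t + 2)) = (l + m) * of_real (y (t + 1)) - l * m * of_real (y t)" for t
  proof -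
    have "y (t + 2) = - b * y (t + 1) - c * y t" using rec[of t] by simp
    then show ?thesis unfolding lm
      by (metis of_real_diff of_real_minus of_real_mult)
  qed
  from periodic_second_order_const[OF N_pos _ this lm(3,4), of t] assms(1)
  show ?thesis by (simp add: periodic_def)
qed

text \<open>The characteristic polynomial is reversed, so its roots are \<open>1 / l\<close> and
  \<open>1 / m\<close>, and these are \<open>N\<close>-th roots of unity only if \<open>l\<close>
  and \<open>m\<close> are.\<close>

lemma periodic_adjoint_kernel_const:
  fixes y :: "nat \<Rightarrow> real"
  assumes "periodic N y" and rec: "\<And>t. c * y (t + 2) + b * y (t + 1) + y t = 0"
  shows "y t = y 0"
proof -
  obtain l m :: complex where lm: "l + m = - of_real b" "l * m = of_real c"
    "l ^ N = 1 \<Longrightarrow> l = 1" "m ^ N = 1 \<Longrightarrow> m = 1"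
    by (rule characteristic_roots) blast
  have nz: "l \<noteq> 0" "m \<noteq> 0" using lm(2) c_nz by auto
  have *: "1 / l + 1 / m = of_real (- b / c)" "1 / l * (1 / m) = of_real (1 / c)"
    using nz lm(1,2) by (simp_all add: field_simps)
  have roots: "(1 / l) ^ N = 1 \<Longrightarrow> 1 / l = 1" "(1 / m) ^ N = 1 \<Longrightarrow> 1 / m = 1"
    using lm(3,4) by (simp_all add: power_one_over)
  have rec': "complex_of_real (y (t + 2)) =
    (1 / l + 1 / m) * of_real (y (t + 1)) - 1 / l * (1 / m) * of_real (y t)" for t
  proof -
    have "y (t + 2) = - b / c * y (t + 1) - 1 / c * y t"
      using rec[of t] c_nz by (simp add: field_simps)
    then show ?thesis unfolding * by (metis of_real_diff of_real_mult)
  qed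
  have "periodic N (\<lambda>t. complex_of_real (y t))" using assms(1) by (simp add: periodic_def)
  from periodic_second_order_const[OF N_pos this rec' roots, of t]
  show ?thesis by simp
qed

text \<open>
  If \<open>1 + b + c = 0\<close>, then \<open>e\<close> and \<open>psi\<close> span the kernels of \<open>L_op\<close> and \<open>L_star\<close>;
  otherwise both kernels are trivial.  Setting \<open>e = psi = 0\<close> in the second case, and
  relying on \<open>0 / 0 = 0\<close> in \<open>kappa\<close>, lets both cases be treated at once.
\<close>

definition e :: "real^2" where "e = (if 1 + b + c = 0 then vector [1, 1] else 0)"

definition psi :: "real^2" where "psi = (if 1 + b + c = 0 then vector [- c, 1] else 0)"

definition kappa :: "(nat \<Rightarrow> real^2) \<Rightarrow> real"
  where "kappa h = (\<Sum>i<N. psi \<bullet> h i) / (real N * (psi \<bullet> psi))"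

lemma psi_eq_0_iff: "psi = 0 \<longleftrightarrow> 1 + b + c \<noteq> 0"
  by (simp add: psi_def vec_eq_iff forall_2)

lemma e_eq_0_iff: "e = 0 \<longleftrightarrow> 1 + b + c \<noteq> 0"
  by (simp add: e_def vec_eq_iff forall_2)

lemma A_mult_e: "A_mat b c *v e = e"
  by (auto simp: e_def A_mat_mult vec_eq_iff forall_2)

text \<open>\<open>psi\<close> is zero or a left eigenvector of A for the eigenvalue 1. Hence its
  pairing with a homogeneous trajectory is conserved, which is the source of the solvability
  condition.\<close>

lemma psi_inner_A_mult: "psi \<bullet> (A_mat b c *v x) = psi \<bullet> x"
proof -
  have "- (c * x $ 1) - b * x $ 2 - c * x $ 2 = x $ 2 - c * x $ 1 - (1 + b + c) * x $ 2"
    by (simp add: algebra_simps)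
  then show ?thesis
    by (auto simp: psi_def A_mat_mult inner_vec_def sum_2)
qed

lemma psi_mult_A: "psi v* A_mat b c = psi"
  by (auto simp: psi_def mult_A_mat vec_eq_iff forall_2)

text \<open>The first component solves the homogeneous scalar equation, so it is constant, and a
  nonzero constant solves that equation only if \<open>1 + b + c = 0\<close>.\<close>

lemma L_kernel:
  assumes "periodic N x" and rec: "\<And>t. x (Suc t) = A_mat b c *v x t"
  shows "\<exists>k. \<forall>t. x t = k *\<^sub>R e"
proof -
  define y where "y t = x t $ 1" for t
  have 2: "x t $ 2 = y (t + 1)" for t
    by (simp add: y_def rec A_mat_mult)
  have eq: "y (t + 2) + b * y (t + 1) + c * y t = 0" for t
    using arg_cong[OF rec[of t], of "\<lambda>v. v $ 2"]
    by (simp add: A_mat_mult) (simp add: 2 y_def)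
  have "periodic N y" using assms(1) by (simp add: periodic_def y_def)
  then have const: "y t = y 0" for t by (rule periodic_kernel_const) (rule eq)
  have "y 0 + b * y 0 + c * y 0 = 0" 
    using eq[of 0] const[of "0 + 2"] const[of "0 + 1"] by (simp only:)
  then have "(1 + b + c) * y 0 = 0" by (simp add: algebra_simps)
  moreover have "x t = vector [y 0, y 0]" for t
    using const[of t] const[of "t + 1"] 2[of t] by (simp add: vec_eq_iff forall_2 y_def)
  ultimately show ?thesis
    by (intro exI[of _ "y 0"]) (auto simp: e_def vec_eq_iff forall_2)
qed

text \<open>Multiplying the adjoint equation by the transpose of A removes the inverse matrix; the
  second component then solves the reversed scalar equation.\<close>

lemma L_star_kernel:
  assumes "periodic N x" and rec: "\<And>t. transpose (A_mat b c) *v x (Suc t) = x t"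
  shows "\<exists>k. \<forall>t. x t = k *\<^sub>R psi"
proof -
  define y where "y t = x t $ 2" for t
  have 1: "x t $ 1 = - c * y (t + 1)" for t
    using arg_cong[OF rec[of t], of "\<lambda>v. v $ 1"] by (simp add: mult_A_mat y_def)
  have eq: "c * y (t + 2) + b * y (t + 1) + y t = 0" for t
    using arg_cong[OF rec[of t], of "\<lambda>v. v $ 2"] 1[of "t + 1"]
    by (simp add: mult_A_mat y_def)
  have "periodic N y" using assms(1) by (simp add: periodic_def y_def)
  then have const: "y t = y 0" for t by (rule periodic_adjoint_kernel_const) (rule eq)
  have "c * y 0 + b * y 0 + y 0 = 0" 
    using eq[of 0] const[of "0 + 2"] const[of "0 + 1"] by (simp only:)
  then have "(1 + b + c) * y 0 = 0" by (simp add: algebra_simps)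
  moreover have "x t = vector [- c * y 0, y 0]" for t
    using const[of t] const[of "t + 1"] 1[of t] by (simp add: vec_eq_iff forall_2 y_def)
  ultimately show ?thesis
    by (intro exI[of _ "y 0"]) (auto simp: psi_def vec_eq_iff forall_2)
qed

text \<open>Fixed vectors of the \<open>N\<close>-th power of A are exactly the initial values of
  \<open>N\<close>-periodic homogeneous trajectories, so \<open>L_kernel\<close> applies.\<close>

lemma kernel_monodromy: "{v. (mat 1 - mat_power (A_mat b c) N) *v v = 0} = span {e}"
proof (intro equalityI subsetI)
  fix v assume "v \<in> {v. (mat 1 - mat_power (A_mat b c) N) *v v = 0}"
  then have v: "mat_power (A_mat b c) N *v v = v"
    by (simp add: matrix_vector_mult_diff_rdistrib)
  define x where "x t = mat_power (A_mat b c) t *v v" for t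
  have rec: "x (Suc t) = A_mat b c *v x t" for t
    by (simp add: x_def matrix_vector_mul_assoc)
  have "periodic N x"
    by (rule periodic_trajectory[where f = "\<lambda>t. (*v) (A_mat b c)"]) (simp_all add: rec, simp add: x_def v)
  from L_kernel[OF this rec] obtain k where "x 0 = k *\<^sub>R e" by blast
  then have "v = k *\<^sub>R e" by (simp add: x_def)
  then show "v \<in> span {e}" unfolding span_singleton by blast
next
  fix v assume "v \<in> span {e}"
  then obtain k where v: "v = k *\<^sub>R e" unfolding span_singleton by blast
  have "v = mat_power (A_mat b c) N *v v"
    by (rule mat_power_trajectory[of "\<lambda>t. v"]) (simp add: v matrix_vector_mult_scaleR A_mult_e)
  then show "v \<in> {v. (mat 1 - mat_power (A_mat b c) N) *v v = 0}"
    by (simp add: matrix_vector_mult_diff_rdistrib)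
qed

lemma V_proj_eq_0_iff: "V_proj b c N v = 0 \<longleftrightarrow> e \<bullet> v = 0"
proof -
  have "(\<forall>s\<in>span {e}. orthogonal v s) \<longleftrightarrow> orthogonal v e"
    using orthogonal_to_span[of _ "{e}" v] span_base[of e "{e}"] by blast
  then show ?thesis
    unfolding V_proj_def kernel_monodromy orth_proj_eq_0_iff[OF subspace_span]
    by (simp add: orthogonal_def inner_commute)
qed

text \<open>Evaluating at \<open>t = 0\<close> recovers V x(0), so membership in Ker(P) is one
  linear condition on the initial value.\<close>

lemma ker_P_op: "ker_on N (P_op b c N) = {x \<in> X_space N. e \<bullet> x 0 = 0}"
proof -
  have "P_op b c N x = (\<lambda>t. 0) \<longleftrightarrow> V_proj b c N (x 0) = 0" for x
    by (auto simp: P_op_def fun_eq_iff dest: spec[of _ 0])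
  then show ?thesis by (simp add: ker_on_def V_proj_eq_0_iff)
qed

lemma ker_L_star: "ker_on N (L_star b c) = range (\<lambda>a t. a *\<^sub>R psi)"
proof -
  let ?A = "A_mat b c"
  have inv: "?A ** matrix_inv ?A = mat 1" "matrix_inv ?A ** ?A = mat 1"
    using invertible_A_mat[OF c_nz] by (auto simp: invertible_def matrix_inv_def intro: someI2_ex)
  have 1: "v v* matrix_inv ?A v* ?A = v" for v
    by (simp add: vector_matrix_mul_assoc inv)
  have 2: "v v* ?A v* matrix_inv ?A = v" for v
    by (simp add: vector_matrix_mul_assoc inv)
  show ?thesis
  proof (intro equalityI subsetI)
    fix x :: "nat \<Rightarrow> real^2" assume x: "x \<in> ker_on N (L_star b c)"
    then have "x (Suc t) = x t v* matrix_inv ?A" for t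
      by (simp add: ker_on_def L_star_def fun_eq_iff)
    then have "transpose ?A *v x (Suc t) = x t" for t by (simp add: 1)
    moreover have "periodic N x" using x by (simp add: ker_on_def X_space_def)
    ultimately show "x \<in> range (\<lambda>a t. a *\<^sub>R psi)"
      using L_star_kernel[of x] by (auto simp: image_def fun_eq_iff)
  next
    fix x :: "nat \<Rightarrow> real^2" assume "x \<in> range (\<lambda>a t. a *\<^sub>R psi)"
    then obtain k where x: "x = (\<lambda>t. k *\<^sub>R psi)" by auto
    have "psi v* matrix_inv ?A = psi" using 2[of psi] by (simp add: psi_mult_A)
    then show "x \<in> ker_on N (L_star b c)"
      by (simp add: x ker_on_def X_space_def periodic_def L_star_def scaleR_vector_matrix_assoc)
  qed
qed

text \<open>\<open>Psi\<close> comes from a choice operator and is known only as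
  \<open>k *\<^sub>R psi\<close> with \<open>k \<noteq> 0\<close>; the factors \<open>k\<close>
  cancel in Q. If \<open>psi = 0\<close>, both sides vanish.\<close>

lemma Q_op_eq: "Q_op b c N h = (\<lambda>t. kappa h *\<^sub>R psi)"
proof (cases "psi = 0")
  case True
  then show ?thesis by (simp add: Q_op_def ker_L_star image_constant_conv)
next
  case False
  let ?u = "\<lambda>_ :: nat. psi"
  have u: "?u \<noteq> (\<lambda>t. 0)" using False by (simp add: fun_eq_iff)
  have "?u \<in> ker_on N (L_star b c)"
    unfolding ker_L_star by (rule range_eqI[of _ _ 1]) simp
  then have ne: "ker_on N (L_star b c) \<noteq> {\<lambda>t. 0}" using u by blast
  have ex: "?u \<noteq> (\<lambda>t. 0) \<and> ker_on N (L_star b c) = range (\<lambda>a t. a *\<^sub>R ?u t)"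
    using u ker_L_star by blast
  have P: "Psi b c N \<noteq> (\<lambda>t. 0) \<and> ker_on N (L_star b c) = range (\<lambda>a t. a *\<^sub>R Psi b c N t)"
    unfolding Psi_def
    by (rule someI_ex[of "\<lambda>\<psi>. \<psi> \<noteq> (\<lambda>t. 0) \<and>
      ker_on N (L_star b c) = range (\<lambda>a t. a *\<^sub>R \<psi> t)"]) (rule exI[of _ ?u], rule ex)
  have "Psi b c N \<in> ker_on N (L_star b c)"
    unfolding conjunct2[OF P] by (rule range_eqI[of _ _ 1]) simp
  then obtain k where k: "Psi b c N = (\<lambda>t. k *\<^sub>R psi)"
    unfolding ker_L_star by auto
  have "k \<noteq> 0" using P k by auto
  have "Q_op b c N h t = kappa h *\<^sub>R psi" for t
  proof -
    have 1: "(\<Sum>j<N. (norm (Psi b c N j))\<^sup>2) = k\<^sup>2 * (real N * (psi \<bullet> psi))"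
      by (simp add: k power_mult_distrib power2_norm_eq_inner)
    have 2: "(\<Sum>i<N. Psi b c N i \<bullet> h i) = k * (\<Sum>i<N. psi \<bullet> h i)"
      by (simp add: k sum_distrib_left)
    have "Q_op b c N h t =
      (inverse (\<Sum>j<N. (norm (Psi b c N j))\<^sup>2) * (\<Sum>i<N. Psi b c N i \<bullet> h i)) *\<^sub>R Psi b c N t"
      using ne by (simp add: Q_op_def)
    also have "\<dots> =
      (inverse (k\<^sup>2 * (real N * (psi \<bullet> psi))) * (k * (\<Sum>i<N. psi \<bullet> h i)) * k) *\<^sub>R psi"
      unfolding 1 2 by (simp only: k scaleR_scaleR)
    also have "inverse (k\<^sup>2 * (real N * (psi \<bullet> psi))) * (k * (\<Sum>i<N. psi \<bullet> h i)) * k = kappa h"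
      using \<open>k \<noteq> 0\<close> by (simp add: kappa_def power2_eq_square field_simps)
    finally show ?thesis .
  qed
  then show ?thesis by (rule ext)
qed

section \<open>The operator \<open>M_p (I - Q)\<close>: uniqueness, existence and linearity\<close>

definition T :: "(nat \<Rightarrow> real^2) \<Rightarrow> nat \<Rightarrow> real^2"
  where "T = M_p_I_minus_Q b c N"

text \<open>This is L w = (I - Q) h with w in Ker(P), written as a recurrence so that M_p (I - Q)
  can be handled without \<open>inv_into\<close>.\<close>

definition solves :: "(nat \<Rightarrow> real^2) \<Rightarrow> (nat \<Rightarrow> real^2) \<Rightarrow> bool"
  where "solves h w \<longleftrightarrow> periodic N w \<and> e \<bullet> w 0 = 0 \<and>
    (\<forall>t. w (Suc t) = A_mat b c *v w t + h t - kappa h *\<^sub>R psi)"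

text \<open>The difference of two solutions is a multiple of \<open>e\<close> by
  \<open>L_kernel\<close> and is orthogonal to \<open>e\<close> at time 0.\<close>

lemma solves_unique:
  assumes "solves h w" and "solves h w'"
  shows "w = w'"
proof -
  let ?d = "\<lambda>t. w t - w' t"
  have "periodic N ?d" using assms by (simp add: solves_def periodic_def)
  moreover have "?d (Suc t) = A_mat b c *v ?d t" for t
    using assms by (simp add: solves_def matrix_vector_mult_diff_distrib)
  ultimately have "\<exists>k. \<forall>t. ?d t = k *\<^sub>R e" by (rule L_kernel)
  then obtain k where k: "\<And>t. ?d t = k *\<^sub>R e" by blast
  have "e \<bullet> ?d 0 = 0" using assms by (simp add: solves_def inner_diff_right)
  then have "k *\<^sub>R e = 0" unfolding k by auto
  then have "w t - w' t = 0" for t using k[of t] by (simp only:)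
  then have "w t = w' t" for t by simp
  then show ?thesis by (rule ext)
qed

text \<open>
  The correction \<open>(e \<bullet> v) psi\<close> makes the singular map \<open>I - A\<^sup>N\<close> invertible, and it vanishes
  when the right-hand side is orthogonal to \<open>psi\<close>.
\<close>

lemma solvable_monodromy:
  assumes "psi \<bullet> p = 0"
  shows "\<exists>v. e \<bullet> v = 0 \<and> v - mat_power (A_mat b c) N *v v = p"
proof -
  let ?B = "mat_power (A_mat b c) N"
  let ?f = "\<lambda>v. (v - ?B *v v) + (e \<bullet> v) *\<^sub>R psi"
  have psi_B: "psi \<bullet> (mat_power (A_mat b c) n *v v) = psi \<bullet> v" for n v
  proof (induction n)
    case (Suc n)
    then show ?case by (simp only: mat_power_Suc_mult psi_inner_A_mult)
  qed simp
  have psi_f: "psi \<bullet> ?f v = (e \<bullet> v) * (psi \<bullet> psi)" for v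
    by (simp add: inner_add_right inner_diff_right psi_B)
  \<comment> \<open>Either \<open>e\<close> is zero, or \<open>psi\<close> is nonzero and
    \<open>psi_f\<close> can be divided by \<open>psi \<bullet> psi\<close>.\<close>
  have orth: "e \<bullet> v = 0" if "psi \<bullet> ?f v = 0" for v
    using that psi_eq_0_iff e_eq_0_iff unfolding psi_f by auto
  have lin: "linear ?f"
    by (intro linear_compose_add linear_compose_sub linear_ident matrix_vector_mul_linear)
      (simp add: linear_iff inner_add_right scaleR_add_left)
  have "v = 0" if "?f v = 0" for v
  proof -
    have ev: "e \<bullet> v = 0" using orth[of v] that by simp
    then have "v - ?B *v v = 0" using that by simp
    then have "v \<in> span {e}"
      unfolding kernel_monodromy[symmetric] by (simp add: matrix_vector_mult_diff_rdistrib)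
    then obtain k where v: "v = k *\<^sub>R e" unfolding span_singleton by blast
    then have "v \<bullet> v = k * (e \<bullet> v)" by simp
    then show ?thesis using ev by simp
  qed
  then have "inj ?f" unfolding linear_injective_0[OF lin] by blast
  then have "surj ?f" by (rule linear_injective_imp_surjective[OF lin _ refl])
  then obtain v where v: "p = ?f v" by blast
  then have "e \<bullet> v = 0" using orth assms by simp
  then show ?thesis using v by auto
qed

text \<open>Variation of constants: with \<open>u\<close> the forced trajectory from 0, the solution
  starting at \<open>v\<close> returns after \<open>N\<close> steps iff (I - A^N) v =
  \<open>u N\<close>. Subtracting \<open>kappa h *\<^sub>R psi\<close> makes \<open>u N\<close>
  orthogonal to \<open>psi\<close>, as \<open>solvable_monodromy\<close> requires.\<close>

lemma solves_exists:
  assumes h: "periodic N h"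
  shows "\<exists>w. solves h w"
proof -
  define f where "f t = h t - kappa h *\<^sub>R psi" for t
  define u where "u = rec_nat 0 (\<lambda>t x. A_mat b c *v x + f t)"
  have u: "u 0 = 0" "u (Suc t) = A_mat b c *v u t + f t" for t
    by (simp_all add: u_def)
  have psi_u: "psi \<bullet> u n = (\<Sum>t<n. psi \<bullet> f t)" for n
    by (induction n) (simp_all add: u inner_add_right psi_inner_A_mult)
  have "psi \<bullet> u N = (\<Sum>t<N. psi \<bullet> h t) - real N * (kappa h * (psi \<bullet> psi))"
    by (simp add: psi_u f_def inner_diff_right sum_subtractf)
  also have "\<dots> = 0" using N_pos by (simp add: kappa_def)
  finally obtain v where v: "e \<bullet> v = 0" "v - mat_power (A_mat b c) N *v v = u N"
    using solvable_monodromy by blast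
  define w where "w t = mat_power (A_mat b c) t *v v + u t" for t
  have w0: "w 0 = v" by (simp add: w_def u)
  have rec: "w (Suc t) = A_mat b c *v w t + f t" for t
    by (simp add: w_def u matrix_vector_right_distrib matrix_vector_mul_assoc)
  have "periodic N w"
  proof (rule periodic_trajectory)
    show "w (Suc t) = (\<lambda>t x. A_mat b c *v x + f t) t (w t)" for t by (rule rec)
    show "(\<lambda>x. A_mat b c *v x + f (t + N)) = (\<lambda>x. A_mat b c *v x + f t)" for t
      using h by (simp add: f_def periodic_def)
    have "w N = v - u N + u N" unfolding w_def v(2)[symmetric] by simp
    then show "w N = w 0" by (simp add: w0)
  qed
  then have "solves h w" using v(1) by (simp add: solves_def w0 rec) (simp add: f_def)
  then show ?thesis by blast
qed

text \<open>\<open>inv_into\<close> returns \<open>w\<close> once \<open>L_op\<close> is injective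
  on Ker(P), which is \<open>solves_unique\<close> for right-hand side zero.\<close>

lemma T_eq:
  assumes "solves h w"
  shows "T h = w"
proof -
  have ker: "ker_on N (P_op b c N) = {x. periodic N x \<and> e \<bullet> x 0 = 0}"
    by (auto simp: ker_P_op X_space_def)
  have "inj_on (L_op b c) (ker_on N (P_op b c N))"
  proof (rule inj_onI)
    fix x y
    assume x: "x \<in> ker_on N (P_op b c N)" and y: "y \<in> ker_on N (P_op b c N)"
      and eq: "L_op b c x = L_op b c y"
    let ?d = "\<lambda>t. x t - y t"
    have "?d (Suc t) = A_mat b c *v ?d t" for t
      using fun_cong[OF eq, of t] by (simp add: L_op_def matrix_vector_mult_diff_distrib algebra_simps)
    then have "solves (\<lambda>t. 0) ?d"
      using x y by (simp add: solves_def ker periodic_def inner_diff_right kappa_def)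
    moreover have "solves (\<lambda>t. 0) (\<lambda>t. 0)"
      by (simp add: solves_def periodic_def kappa_def)
    ultimately have "?d = (\<lambda>t. 0)" by (rule solves_unique)
    then show "x = y" by (simp add: fun_eq_iff)
  qed
  moreover have "w \<in> ker_on N (P_op b c N)" using assms by (simp add: ker solves_def)
  moreover have "L_op b c w = (\<lambda>t. h t - Q_op b c N h t)"
    using assms by (simp add: solves_def L_op_def Q_op_eq)
  ultimately show ?thesis
    unfolding T_def M_p_I_minus_Q_def M_p_def by (metis inv_into_f_f)
qed

lemma solves_T: "periodic N h \<Longrightarrow> solves h (T h)"
  using solves_exists T_eq by blast

lemma kappa_sum_scaleR:
  "kappa (\<lambda>t. \<Sum>i\<in>I. a i *\<^sub>R h i t) = (\<Sum>i\<in>I. a i * kappa (h i))"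
proof -
  have "(\<Sum>j<N. psi \<bullet> (\<Sum>i\<in>I. a i *\<^sub>R h i j)) = (\<Sum>j<N. \<Sum>i\<in>I. a i * (psi \<bullet> h i j))"
    by (simp add: inner_sum_right)
  also have "\<dots> = (\<Sum>i\<in>I. \<Sum>j<N. a i * (psi \<bullet> h i j))" by (rule sum.swap)
  finally show ?thesis
    by (simp add: kappa_def sum_divide_distrib sum_distrib_left)
qed

text \<open>The combined solutions solve the combined equation, and \<open>T_eq\<close> identifies
  them with the value of \<open>T\<close>.\<close>

lemma T_sum_scaleR:
  assumes "finite I" and "\<And>i. i \<in> I \<Longrightarrow> periodic N (h i)"
  shows "T (\<lambda>t. \<Sum>i\<in>I. a i *\<^sub>R h i t) = (\<lambda>t. \<Sum>i\<in>I. a i *\<^sub>R T (h i) t)"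
proof (rule T_eq)
  have s: "periodic N (T (h i))" "e \<bullet> T (h i) 0 = 0"
    "T (h i) (Suc t) = A_mat b c *v T (h i) t + h i t - kappa (h i) *\<^sub>R psi" if "i \<in> I" for i t
    using solves_T[OF assms(2)[OF that]] by (simp_all add: solves_def)
  have "(\<Sum>i\<in>I. a i *\<^sub>R T (h i) (Suc t)) =
    A_mat b c *v (\<Sum>i\<in>I. a i *\<^sub>R T (h i) t) + (\<Sum>i\<in>I. a i *\<^sub>R h i t)
      - (\<Sum>i\<in>I. a i * kappa (h i)) *\<^sub>R psi" for t
  proof -
    have "(\<Sum>i\<in>I. a i *\<^sub>R T (h i) (Suc t)) =
      (\<Sum>i\<in>I. a i *\<^sub>R (A_mat b c *v T (h i) t) + a i *\<^sub>R h i t - (a i * kappa (h i)) *\<^sub>R psi)"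
      by (intro sum.cong refl) (simp add: s algebra_simps)
    then show ?thesis
      by (simp add: sum.distrib sum_subtractf scaleR_sum_left matrix_vector_mult_scaleR
          linear_sum[OF matrix_vector_mul_linear])
  qed
  moreover have "periodic N (\<lambda>t. \<Sum>i\<in>I. a i *\<^sub>R T (h i) t)"
    using s(1) by (simp add: periodic_def)
  moreover have "e \<bullet> (\<Sum>i\<in>I. a i *\<^sub>R T (h i) 0) = 0"
    by (simp add: inner_sum_right s(2))
  ultimately show "solves (\<lambda>t. \<Sum>i\<in>I. a i *\<^sub>R h i t) (\<lambda>t. \<Sum>i\<in>I. a i *\<^sub>R T (h i) t)"
    by (simp add: solves_def kappa_sum_scaleR)
qed

section \<open>Impulse expansion, operator norm bound and continuity\<close>

definition impulse :: "nat \<times> 2 \<Rightarrow> nat \<Rightarrow> real^2"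
  where "impulse i t = (if t mod N = fst i then axis (snd i) 1 else 0)"

lemma periodic_eq_sum_impulse:
  assumes "periodic N h"
  shows "h t = (\<Sum>i\<in>{..<N} \<times> UNIV. (h (fst i) $ snd i) *\<^sub>R impulse i t)"
proof -
  have "(\<Sum>i\<in>{..<N} \<times> UNIV. (h (fst i) $ snd i) *\<^sub>R impulse i t) =
    (\<Sum>j<N. \<Sum>k\<in>UNIV. if t mod N = j then (h j $ k) *\<^sub>R axis k 1 else 0)"
    unfolding sum.cartesian_product by (intro sum.cong refl) (auto simp: impulse_def)
  also have "\<dots> = (\<Sum>j<N. if t mod N = j then h j else 0)"
    by (intro sum.cong refl) (auto simp: basis_expansion scalar_mult_eq_scaleR[symmetric])
  also have "\<dots> = h (t mod N)" using N_pos by simp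
  finally show ?thesis using periodic_mod[OF assms] by simp
qed

text \<open>Finite dimensionality of X_N in explicit form: \<open>T h t\<close> is a fixed finite
  linear combination of the entries of \<open>h\<close>, which yields both boundedness and
  continuity of \<open>T\<close>.\<close>

lemma T_eq_sum_impulse:
  assumes "periodic N h"
  shows "T h t = (\<Sum>i\<in>{..<N} \<times> UNIV. (h (fst i) $ snd i) *\<^sub>R T (impulse i) t)"
proof -
  have "periodic N (impulse i)" for i by (simp add: periodic_def impulse_def)
  then have "T (\<lambda>t. \<Sum>i\<in>{..<N} \<times> UNIV. (h (fst i) $ snd i) *\<^sub>R impulse i t) t =
      (\<Sum>i\<in>{..<N} \<times> UNIV. (h (fst i) $ snd i) *\<^sub>R T (impulse i) t)"
    by (subst T_sum_scaleR) auto
  then show ?thesis using periodic_eq_sum_impulse[OF assms, symmetric] by simp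
qed

lemma bdd_above_periodic:
  fixes h :: "nat \<Rightarrow> real^2"
  assumes "periodic N h"
  shows "bdd_above (range (\<lambda>t. norm (h t)))"
proof (rule bdd_aboveI2)
  fix t
  have "norm (h (t mod N)) \<le> (\<Sum>j<N. norm (h j))"
    using N_pos by (intro member_le_sum) auto
  then show "norm (h t) \<le> (\<Sum>j<N. norm (h j))" by (simp add: periodic_mod[OF assms])
qed

lemma norm_le_sup_norm: "periodic N h \<Longrightarrow> norm (h t) \<le> sup_norm h"
  unfolding sup_norm_def by (intro cSUP_upper bdd_above_periodic) simp

text \<open>A real supremum dominates its members only for a set bounded above; the impulse
  expansion supplies the bound \<open>C\<close>. Rescaling \<open>h\<close> by
  \<open>1 / \<delta>\<close> then places it in the unit ball.\<close>

lemma norm_T_le: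
  assumes h: "periodic N h" and le: "\<And>t. norm (h t) \<le> \<delta>" and "\<delta> > 0"
  shows "norm (T h t) \<le> op_norm N T * \<delta>"
proof -
  let ?B = "{\<phi> \<in> X_space N. sup_norm \<phi> \<le> 1}"
  define C where "C = (\<Sum>i\<in>{..<N} \<times> UNIV. sup_norm (T (impulse i)))"
  have bound: "sup_norm (T \<phi>) \<le> C" if "\<phi> \<in> ?B" for \<phi>
    unfolding sup_norm_def
  proof (rule cSUP_least)
    fix t
    have \<phi>: "periodic N \<phi>" "sup_norm \<phi> \<le> 1" using that by (auto simp: X_space_def)
    have "norm (T \<phi> t) \<le> (\<Sum>i\<in>{..<N} \<times> UNIV. norm ((\<phi> (fst i) $ snd i) *\<^sub>R T (impulse i) t))"
      unfolding T_eq_sum_impulse[OF \<phi>(1)] by (rule norm_sum)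
    also have "\<dots> \<le> C"
      unfolding C_def
    proof (rule sum_mono)
      fix i :: "nat \<times> 2"
      have "\<bar>\<phi> (fst i) $ snd i\<bar> \<le> norm (\<phi> (fst i))" by (rule component_le_norm_cart)
      also have "\<dots> \<le> 1" using norm_le_sup_norm[OF \<phi>(1)] \<phi>(2) order_trans by blast
      finally have 1: "\<bar>\<phi> (fst i) $ snd i\<bar> \<le> 1" .
      have "periodic N (T (impulse i))"
        using solves_T[of "impulse i"] by (simp add: solves_def periodic_def impulse_def)
      then have "norm (T (impulse i) t) \<le> sup_norm (T (impulse i))" by (rule norm_le_sup_norm)
      then show "norm ((\<phi> (fst i) $ snd i) *\<^sub>R T (impulse i) t) \<le> sup_norm (T (impulse i))"
        using mult_mono[OF 1] by fastforce
    qed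
    finally show "norm (T \<phi> t) \<le> C" .
  qed simp
  let ?h = "\<lambda>t. (1 / \<delta>) *\<^sub>R h t"
  have perh: "periodic N ?h" using h by (simp add: periodic_def)
  have "sup_norm ?h \<le> 1"
    unfolding sup_norm_def using le \<open>\<delta> > 0\<close> by (intro cSUP_least) (auto simp: field_simps)
  then have "?h \<in> ?B" using perh by (simp add: X_space_def)
  then have "sup_norm (T ?h) \<le> op_norm N T"
    unfolding op_norm_def using bound by (intro cSUP_upper bdd_aboveI2) auto
  moreover have "norm (T ?h t) \<le> sup_norm (T ?h)"
    using solves_T[OF perh] by (intro norm_le_sup_norm) (simp add: solves_def)
  \<comment> \<open>Homogeneity is linearity over a one-element index set.\<close>
  moreover have "T ?h t = (1 / \<delta>) *\<^sub>R T h t"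
    using T_sum_scaleR[of "{()}" "\<lambda>_. h" "\<lambda>_. 1 / \<delta>"] h by simp
  ultimately have "norm (T h t) / \<delta> \<le> op_norm N T" using \<open>\<delta> > 0\<close> by simp
  then show ?thesis using \<open>\<delta> > 0\<close> by (simp add: field_simps)
qed

lemma continuous_on_T:
  assumes "\<And>p. periodic N (H p)" and "\<And>t. continuous_on S (\<lambda>p. H p t)"
  shows "continuous_on S (\<lambda>p. T (H p) t)"
  unfolding T_eq_sum_impulse[OF assms(1)] by (intro continuous_intros assms(2))

text \<open>This confines the unknown \<open>q\<close> to a compact interval. The quotient is left
  uncancelled so that for \<open>psi = 0\<close> both sides are 0.\<close>

lemma abs_kappa_le:
  assumes "\<And>t. norm (h t) \<le> \<delta>"
  shows "\<bar>kappa h\<bar> \<le> (real N * (norm psi * \<delta>)) / (real N * (psi \<bullet> psi))"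
proof -
  have "\<bar>\<Sum>i<N. psi \<bullet> h i\<bar> \<le> (\<Sum>i<N. norm psi * \<delta>)"
  proof (rule order_trans[OF sum_abs sum_mono])
    fix i
    have "\<bar>psi \<bullet> h i\<bar> \<le> norm psi * norm (h i)" by (rule Cauchy_Schwarz_ineq2)
    also have "\<dots> \<le> norm psi * \<delta>" using assms by (intro mult_left_mono) auto
    finally show "\<bar>psi \<bullet> h i\<bar> \<le> norm psi * \<delta>" .
  qed
  then have "\<bar>\<Sum>i<N. psi \<bullet> h i\<bar> \<le> real N * (norm psi * \<delta>)" by simp
  moreover have nonneg: "0 \<le> real N * (psi \<bullet> psi)" by simp
  ultimately show ?thesis
    unfolding kappa_def abs_divide abs_of_nonneg[OF nonneg] by (rule divide_right_mono)
qed

lemma continuous_on_kappa: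
  assumes "\<And>t. continuous_on S (\<lambda>p. H p t)"
  shows "continuous_on S (\<lambda>p. kappa (H p))"
  unfolding kappa_def divide_inverse by (intro continuous_intros assms)

end

section \<open>Brouwer fixed point and the sign argument\<close>

definition clip :: "real \<Rightarrow> real \<Rightarrow> real" where "clip a x = max (- a) (min a x)"

lemma clip_bounds: "0 \<le> a \<Longrightarrow> clip a x \<in> {- a..a}"
  by (auto simp: clip_def)

lemma clip_eq: "\<bar>x\<bar> \<le> a \<Longrightarrow> clip a x = x"
  by (auto simp: clip_def)

lemma continuous_on_clip: "continuous_on S f \<Longrightarrow> continuous_on S (\<lambda>x. clip a (f x))"
  unfolding clip_def by (intro continuous_intros)

lemma (in odd_period) exists_periodic_solution:
  fixes g :: "nat \<times> real \<Rightarrow> real" and r zhat \<delta> :: real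
  assumes g_cont: "continuous_on UNIV g"
    and g_per: "\<And>x. periodic N (\<lambda>t. g (t, x))"
    and "r > 0" and "\<delta> > 0" and "zhat > 0"
    and C1: "\<And>t x. x \<in> {- 2 * r..2 * r} \<Longrightarrow> \<bar>g (t, x)\<bar> \<le> \<delta>"
    and C2: "\<And>t x. \<bar>x\<bar> > zhat \<Longrightarrow> x * g (t, x) > 0"
    and C3: "zhat + op_norm N T * \<delta> < r"
  shows "\<exists>y. periodic N y \<and> (\<forall>t. y (t + 2) + b * y (t + 1) + c * y t = g (t, y t))"
proof -
  define R where "R = op_norm N T * \<delta>"
  \<comment> \<open>Clipping at \<open>2 * r\<close> makes the bound of (C1) hold for every
    argument.\<close>
  define F :: "nat \<Rightarrow> real^2 \<Rightarrow> real^2"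
    where "F t x = g (t, clip (2 * r) (x $ 1)) *\<^sub>R axis 2 1" for t x
  have F_le: "norm (F t x) \<le> \<delta>" for t x
    using C1[of "clip (2 * r) (x $ 1)" t] clip_bounds[of "2 * r" "x $ 1"] \<open>r > 0\<close>
    by (simp add: F_def)
  have F_per: "F (t + N) = F t" for t
    using g_per by (simp add: F_def fun_eq_iff periodic_def)
  have F_cont: "continuous_on S (\<lambda>p. F t (f p))"
    if "continuous_on S f" for S t and f :: "real \<times> (real^2) \<times> real \<Rightarrow> real^2"
  proof -
    have "continuous_on S (\<lambda>p. g (t, clip (2 * r) (f p $ 1)))"
      by (rule continuous_on_compose2[OF g_cont]) (intro continuous_intros continuous_on_clip that, simp)
    then show ?thesis unfolding F_def by (intro continuous_intros)
  qed
  \<comment> \<open>Here \<open>p\<close> is the triple (alpha, w(0), q). The number q stands in for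
    \<open>kappa h\<close>, which is known only after a whole period has been computed.\<close>
  define x :: "real \<times> (real^2) \<times> real \<Rightarrow> nat \<Rightarrow> real^2" where
    "x p = rec_nat (fst p *\<^sub>R e + fst (snd p)) (\<lambda>t v. A_mat b c *v v + F t v - snd (snd p) *\<^sub>R psi)" for p
  have x: "x p 0 = fst p *\<^sub>R e + fst (snd p)"
    "x p (Suc t) = A_mat b c *v x p t + F t (x p t) - snd (snd p) *\<^sub>R psi" for p t
    by (simp_all add: x_def)
  have x_cont: "continuous_on S (\<lambda>p. x p t)" for S t
  proof (induction t)
    case 0
    then show ?case unfolding x by (intro continuous_intros)
  next
    case (Suc t)
    have "continuous_on S (\<lambda>p. A_mat b c *v x p t)"
      by (rule linear_continuous_on_compose[OF Suc matrix_vector_mul_linear])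
    then show ?case unfolding x by (intro continuous_intros F_cont Suc)
  qed
  \<comment> \<open>Away from fixed points \<open>x p\<close> need not be periodic, so only its
    first \<open>N\<close> values are used and repeated.\<close>
  define H where "H p t = F (t mod N) (x p (t mod N))" for p t
  have H_per: "periodic N (H p)" for p by (simp add: H_def periodic_def)
  have H_le: "norm (H p t) \<le> \<delta>" for p t by (simp add: H_def F_le)
  have H_cont: "continuous_on S (\<lambda>p. H p t)" for S t
    unfolding H_def by (intro F_cont x_cont)
  have T_le: "norm (T (H p) t) \<le> R" for p t
    unfolding R_def using H_per H_le \<open>\<delta> > 0\<close> by (rule norm_T_le)
  define K where "K = (real N * (norm psi * \<delta>)) / (real N * (psi \<bullet> psi))"
  have K: "\<bar>kappa (H p)\<bar> \<le> K" for p
    unfolding K_def by (rule abs_kappa_le) (rule H_le)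
  define S where "S = {- r..r} \<times> cball (0::real^2) R \<times> {- K..K}"
  define \<Phi> where "\<Phi> p = (clip r (fst p - kappa (H p)), T (H p) 0, kappa (H p))" for p
  have "compact S" "convex S"
    unfolding S_def by (intro compact_Times convex_Times compact_cball convex_cball; simp)+
  \<comment> \<open>Holding for every \<open>p\<close>, this also gives the nonemptiness of
    \<open>S\<close> that Brouwer's theorem requires.\<close>
  moreover have \<Phi>S: "\<Phi> p \<in> S" for p
    using T_le[of p 0] K[of p] clip_bounds[of r] \<open>r > 0\<close> by (auto simp: S_def \<Phi>_def)
  moreover have "continuous_on S \<Phi>"
    unfolding \<Phi>_def
    by (intro continuous_intros continuous_on_clip continuous_on_kappa continuous_on_T H_per H_cont)
  ultimately obtain p where p: "p \<in> S" "\<Phi> p = p"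
    using brouwer[of S \<Phi>] by blast
  define \<alpha> where "\<alpha> = fst p"
  define h where "h = H p"
  define X where "X t = \<alpha> *\<^sub>R e + T h t" for t
  have fixp: "clip r (\<alpha> - kappa h) = \<alpha>" "T h 0 = fst (snd p)" "kappa h = snd (snd p)"
    using arg_cong[OF p(2), of fst] arg_cong[OF p(2), of snd] by (auto simp: \<Phi>_def \<alpha>_def h_def prod_eq_iff)
  have \<alpha>: "\<bar>\<alpha>\<bar> \<le> r" using p(1) by (auto simp: S_def \<alpha>_def)
  have s: "periodic N (T h)" "T h (Suc t) = A_mat b c *v T h t + h t - kappa h *\<^sub>R psi" for t
    using solves_T[OF H_per, of p] by (simp_all add: solves_def h_def)
  have X_rec: "X (Suc t) = A_mat b c *v X t + h t - kappa h *\<^sub>R psi" for t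
    by (simp add: X_def s matrix_vector_right_distrib matrix_vector_mult_scaleR A_mult_e)
  have X_per: "periodic N X" using s(1) by (simp add: X_def periodic_def)
  \<comment> \<open>Restricted to the first period, where \<open>h\<close> is the forcing along
    \<open>x p\<close>; \<open>hF\<close> then extends the agreement by periodicity.\<close>
  have xX: "x p t = X t" if "t < N" for t
    using that
  proof (induction t)
    case 0
    then show ?case by (simp add: x X_def fixp \<alpha>_def)
  next
    case (Suc t)
    then have "x p t = X t" "h t = F t (x p t)" by (simp_all add: h_def H_def)
    then show ?case by (simp add: x X_rec fixp)
  qed
  have hF: "h t = F t (X t)" for t
  proof -
    have "periodic N (\<lambda>t. F t (X t))" using X_per by (simp add: periodic_def F_per)
    from periodic_mod[OF this] show ?thesis using N_pos by (simp add: h_def H_def xX)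
  qed
  have X1: "X t $ 1 = \<alpha> * e $ 1 + T h t $ 1" for t by (simp add: X_def)
  have T1: "\<bar>T h t $ 1\<bar> \<le> R" for t
    using component_le_norm_cart[of "T h t" 1] T_le[of p t] unfolding h_def by linarith
  \<comment> \<open>By (C3), R < r, so the first component stays below r + R < 2r and the clipping
    in \<open>F\<close> is inactive.\<close>
  have "\<bar>\<alpha> * e $ 1\<bar> \<le> r" using \<alpha> \<open>r > 0\<close> by (simp add: e_def)
  then have "\<bar>X t $ 1\<bar> \<le> 2 * r" for t
    using T1[of t] C3 \<open>zhat > 0\<close> unfolding X1 R_def[symmetric] by linarith
  then have hg: "h t = g (t, X t $ 1) *\<^sub>R axis 2 1" for t
    by (simp add: hF F_def clip_eq)
  have "kappa h = 0"
  proof (cases "psi = 0")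
    case True
    then show ?thesis by (simp add: kappa_def)
  next
    case False
    then have res: "1 + b + c = 0" by (simp add: psi_eq_0_iff)
    \<comment> \<open>The second entry of \<open>psi\<close> is 1, so \<open>kappa h\<close> is a
      positive multiple of the sum of g over a period.\<close>
    have psi_h: "psi \<bullet> h t = g (t, X t $ 1)" for t
      by (simp add: hg res psi_def inner_axis)
    have X1': "X t $ 1 = \<alpha> + T h t $ 1" for t using X1 res by (simp add: e_def)
    have pos: "real N * (psi \<bullet> psi) > 0" using False N_pos by simp
    show ?thesis
    proof (rule ccontr)
      assume "kappa h \<noteq> 0"
      then consider "kappa h > 0" | "kappa h < 0" by linarith
      then show False
      proof cases
        case 1
        \<comment> \<open>Subtracting a positive number and clipping returns \<alpha> only at the
          lower end. Then \<open>X t $ 1\<close> is at most -r + R, which is below -zhat by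
          (C3).\<close>
        then have "\<alpha> = - r" using fixp(1) \<alpha> by (auto simp: clip_def max_def min_def split: if_splits)
        then have "X t $ 1 < - zhat" for t using T1[of t] C3 by (simp add: X1' R_def)
        then have "g (t, X t $ 1) \<le> 0" for t
          using C2[of "X t $ 1" t] \<open>zhat > 0\<close>
          by (smt (verit, best) mult_nonneg_nonpos2 mult_nonpos_nonneg)
        then have "kappa h \<le> 0"
          using pos by (simp add: kappa_def psi_h divide_nonpos_pos sum_nonpos)
        then show False using 1 by simp
      next
        case 2
        then have "\<alpha> = r" using fixp(1) \<alpha> by (auto simp: clip_def max_def min_def split: if_splits)
        then have "X t $ 1 > zhat" for t using T1[of t] C3 by (simp add: X1' R_def abs_le_iff)
        then have "g (t, X t $ 1) \<ge> 0" for t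
          using C2[of "X t $ 1" t] \<open>zhat > 0\<close>
          by (smt (verit, best) mult_nonneg_nonpos2 mult_nonneg_nonpos)
        then have "kappa h \<ge> 0"
          using pos by (simp add: kappa_def psi_h sum_nonneg)
        then show False using 2 by simp
      qed
    qed
  qed
  then have rec: "X (Suc t) = A_mat b c *v X t + g (t, X t $ 1) *\<^sub>R axis 2 1" for t
    by (simp add: X_rec hg)
  have 1: "X (Suc t) $ 1 = X t $ 2" for t by (simp add: rec A_mat_mult axis_def)
  have 2: "X (Suc t) $ 2 = - c * X t $ 1 - b * X t $ 2 + g (t, X t $ 1)" for t
    by (simp add: rec A_mat_mult axis_def)
  have "X (t + 2) $ 1 + b * X (t + 1) $ 1 + c * X t $ 1 = g (t, X t $ 1)" for t
    by (simp add: 1 2)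
  moreover have "periodic N (\<lambda>t. X t $ 1)" using X_per by (simp add: periodic_def)
  ultimately show ?thesis by blast
qed

theorem theorem3p1:
  fixes N :: nat and b c r zhat \<delta> :: real and g :: "nat \<times> real \<Rightarrow> real"
  assumes "N > 1" and "odd N" and "c \<noteq> 0"
    and "continuous_on UNIV g"
    and "\<And>x. periodic N (\<lambda>t. g (t, x))"
    and "r > 0" and "zhat > 0" and "\<delta> > 0"
    and C1: "\<And>t x. x \<in> {- 2 * r..2 * r} \<Longrightarrow> \<bar>g (t, x)\<bar> \<le> \<delta>"
    and C2: "\<And>t x. \<bar>x\<bar> > zhat \<Longrightarrow> x * g (t, x) > 0"
    and C3: "zhat + op_norm N (M_p_I_minus_Q b c N) * \<delta> < r"
    and C4: "(\<exists>k::int. real N * arccos (- b / 2) = of_int k * (2 * pi)) \<Longrightarrow> c \<noteq> 1 \<or> 2 \<le> \<bar>b\<bar>"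
  shows "\<exists>y :: nat \<Rightarrow> real. periodic N y \<and>
    (\<forall>t. y (t + 2) + b * y (t + 1) + c * y t = g (t, y t))"
proof -
  interpret odd_period N b c
    by unfold_locales (use assms in blast)+
  show ?thesis
    using exists_periodic_solution[OF assms(4-6) \<open>\<delta> > 0\<close> \<open>zhat > 0\<close> C1 C2] C3
    unfolding T_def by blast
qed

end
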